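(* There exists a structure $\mathcal{M}$ in a relational first-order language which is elementarily indivisible but not symmetrically indivisible.
   Context: Let $\mathcal{M}$ be a structure in a relational first-order language. A substructure $\mathcal{N}\subseteq\mathcal{M}$ is symmetrically embedded in $\mathcal{M}$ if every automorphism of $\mathcal{N}$ extends to an automorphism of $\mathcal{M}$. $\mathcal{M}$ is elementarily indivisible if for every coloring of its universe $M$ in two colors there is a monochromatic substructure $\mathcal{M}'\subseteq\mathcal{M}$ with $\mathcal{M}'\cong\mathcal{M}$ and $\mathcal{M}'\preceq\mathcal{M}$ (elementary substructure). $\mathcal{M}$ is symmetrically indivisible if for every coloring of $M$ in two colors there is a monochromatic substructure $\mathcal{M}'\subseteq\mathcal{M}$ with $\mathcal{M}'\cong\mathcal{M}$ and $\mathcal{M}'$ symmetrically embedded in $\mathcal{M}$. *)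

theory Defs imports Main begin

text \<open>First-order logic with equality over relational languages. Structures carry an explicit
  universe, so that a substructure has the same type as the ambient structure.\<close>

record 'r relational_language =
  symbols :: "'r set"
  arity :: "'r \<Rightarrow> nat"

definition is_language :: "'r relational_language \<Rightarrow> bool" where
  "is_language L \<longleftrightarrow> (\<forall>R\<in>symbols L. arity L R > 0)"

record ('r, 'a) fo_structure =
  universe :: "'a set"
  interp :: "'r \<Rightarrow> 'a list set"

definition tuples :: "'r relational_language \<Rightarrow> 'r \<Rightarrow> 'a set \<Rightarrow> 'a list set" where
  "tuples L R A = {xs. length xs = arity L R \<and> set xs \<subseteq> A}"

definition is_structure ::
    "'r relational_language \<Rightarrow> ('r, 'a) fo_structure \<Rightarrow> bool" where
  "is_structure L M \<longleftrightarrow>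
     universe M \<noteq> {} \<and> (\<forall>R\<in>symbols L. interp M R \<subseteq> tuples L R (universe M))"

text \<open>Variables are named by natural numbers; the remaining connectives and the universal
  quantifier are expressible through those below.\<close>

datatype 'r formula =
    Equal nat nat
  | Rel 'r "nat list"
  | Neg "'r formula"
  | Conj "'r formula" "'r formula"
  | Exists nat "'r formula"

primrec is_formula :: "'r relational_language \<Rightarrow> 'r formula \<Rightarrow> bool" where
  "is_formula L (Equal x y) \<longleftrightarrow> True"
| "is_formula L (Rel R xs) \<longleftrightarrow> R \<in> symbols L \<and> length xs = arity L R"
| "is_formula L (Neg p) \<longleftrightarrow> is_formula L p"
| "is_formula L (Conj p q) \<longleftrightarrow> is_formula L p \<and> is_formula L q"
| "is_formula L (Exists x p) \<longleftrightarrow> is_formula L p"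

primrec satisfies ::
    "('r, 'a) fo_structure \<Rightarrow> (nat \<Rightarrow> 'a) \<Rightarrow> 'r formula \<Rightarrow> bool" where
  "satisfies M v (Equal x y) \<longleftrightarrow> v x = v y"
| "satisfies M v (Rel R xs) \<longleftrightarrow> map v xs \<in> interp M R"
| "satisfies M v (Neg p) \<longleftrightarrow> \<not> satisfies M v p"
| "satisfies M v (Conj p q) \<longleftrightarrow> satisfies M v p \<and> satisfies M v q"
| "satisfies M v (Exists x p) \<longleftrightarrow> (\<exists>a\<in>universe M. satisfies M (v(x := a)) p)"

definition substructure ::
    "'r relational_language \<Rightarrow> ('r, 'a) fo_structure \<Rightarrow> ('r, 'a) fo_structure \<Rightarrow> bool" where
  "substructure L N M \<longleftrightarrow>
     is_structure L N \<and> universe N \<subseteq> universe M \<and>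
     (\<forall>R\<in>symbols L. interp N R = interp M R \<inter> tuples L R (universe N))"

definition elementary_substructure ::
    "'r relational_language \<Rightarrow> ('r, 'a) fo_structure \<Rightarrow> ('r, 'a) fo_structure \<Rightarrow> bool" where
  "elementary_substructure L N M \<longleftrightarrow>
     substructure L N M \<and>
     (\<forall>p v. is_formula L p \<longrightarrow> range v \<subseteq> universe N \<longrightarrow>
        (satisfies N v p \<longleftrightarrow> satisfies M v p))"

definition isomorphism ::
    "'r relational_language \<Rightarrow> ('r, 'a) fo_structure \<Rightarrow> ('r, 'b) fo_structure \<Rightarrow> ('a \<Rightarrow> 'b) \<Rightarrow> bool"
  where
  "isomorphism L M N f \<longleftrightarrow>
     bij_betw f (universe M) (universe N) \<and>
     (\<forall>R\<in>symbols L. \<forall>xs\<in>tuples L R (universe M).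
        xs \<in> interp M R \<longleftrightarrow> map f xs \<in> interp N R)"

definition isomorphic ::
    "'r relational_language \<Rightarrow> ('r, 'a) fo_structure \<Rightarrow> ('r, 'b) fo_structure \<Rightarrow> bool" where
  "isomorphic L M N \<longleftrightarrow> (\<exists>f. isomorphism L M N f)"

text \<open>Only the values on the universe matter, so an automorphism \<open>f\<close> of \<open>N\<close> extends to \<open>g\<close> when
  both agree on the universe of \<open>N\<close>.\<close>

abbreviation automorphism ::
    "'r relational_language \<Rightarrow> ('r, 'a) fo_structure \<Rightarrow> ('a \<Rightarrow> 'a) \<Rightarrow> bool" where
  "automorphism L M f \<equiv> isomorphism L M M f"

definition symmetrically_embedded ::
    "'r relational_language \<Rightarrow> ('r, 'a) fo_structure \<Rightarrow> ('r, 'a) fo_structure \<Rightarrow> bool" where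
  "symmetrically_embedded L N M \<longleftrightarrow>
     substructure L N M \<and>
     (\<forall>f. automorphism L N f \<longrightarrow>
        (\<exists>g. automorphism L M g \<and> (\<forall>x\<in>universe N. g x = f x)))"

definition monochromatic :: "('a \<Rightarrow> bool) \<Rightarrow> ('r, 'a) fo_structure \<Rightarrow> bool" where
  "monochromatic c N \<longleftrightarrow> (\<exists>b. \<forall>x\<in>universe N. c x = b)"

definition elementarily_indivisible ::
    "'r relational_language \<Rightarrow> ('r, 'a) fo_structure \<Rightarrow> bool" where
  "elementarily_indivisible L M \<longleftrightarrow>
     (\<forall>c :: 'a \<Rightarrow> bool. \<exists>N :: ('r, 'a) fo_structure.
        substructure L N M \<and> monochromatic c N \<and> isomorphic L N M \<and>
        elementary_substructure L N M)"

definition symmetrically_indivisible ::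
    "'r relational_language \<Rightarrow> ('r, 'a) fo_structure \<Rightarrow> bool" where
  "symmetrically_indivisible L M \<longleftrightarrow>
     (\<forall>c :: 'a \<Rightarrow> bool. \<exists>N :: ('r, 'a) fo_structure.
        substructure L N M \<and> monochromatic c N \<and> isomorphic L N M \<and>
        symmetrically_embedded L N M)"

end

theory Submission imports Defs "HOL-Library.Nat_Bijection" begin

text \<open>The model is a disjoint union of classes, each of which is a random complete graph with edge
  colours \<open>1, 2, \<dots>\<close> and a hidden colour \<open>None\<close> that belongs to no relation of the language. No
  formula detects the hidden colour, since it mentions only finitely many relations; hence a
  substructure is elementary as soon as it has the extension property for the visible colours. This
  leaves the freedom to vary the hidden colour: class \<open>i\<close> has exactly \<open>i - 1\<close> points without hidden
  edges, and its remaining points form a graph into which every other class embeds, even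
  monochromatically after any colouring. This gives elementary indivisibility.

  Classes \<open>0\<close> and \<open>1\<close> are isomorphic, and no other two are. Colour these two red and all others blue.
  A monochromatic copy is blue, so its own classes \<open>0\<close> and \<open>1\<close> lie in two non-isomorphic classes of
  the model, and the automorphism of the copy that swaps them does not extend.\<close>

section \<open>A generic colouring of pairs of naturals\<close>

text \<open>As in the Rado graph with the BIT predicate, a vertex codes the list of the colours of its
  edges to smaller vertices.\<close>

definition edge :: "nat \<Rightarrow> nat \<Rightarrow> nat" where
  "edge a b = (let l = list_decode b in if a < length l then l ! a else 0)"

lemma length_le_list_encode: "length l \<le> list_encode l"
proof (induction l)
  case (Cons a l)
  then show ?case using le_prod_encode_2[of "list_encode l" a] by simp
qed simp

lemma edge_extend:
  assumes "finite F"
  obtains b where "\<forall>a\<in>F. a < b \<and> edge a b = t a"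
proof -
  \<comment> \<open>\<open>insert 0\<close> covers empty \<open>F\<close>. The code of a list of
    length \<open>k\<close> is at least \<open>k\<close>, hence above all of
    \<open>F\<close>.\<close>
  define k where "k = Suc (Max (insert 0 F))"
  have k: "a < k" if "a \<in> F" for a
    using that assms by (simp add: k_def less_Suc_eq_le)
  define l where "l = map t [0..<k]"
  have "\<forall>a\<in>F. a < list_encode l \<and> edge a (list_encode l) = t a"
    using k length_le_list_encode[of l] by (fastforce simp: edge_def l_def)
  then show ?thesis by (rule that)
qed

section \<open>Classes, visible and hidden colours\<close>

definition point :: "nat \<Rightarrow> nat \<Rightarrow> nat" where
  "point i a = prod_encode (i, a)"

definition cls :: "nat \<Rightarrow> nat" where
  "cls x = fst (prod_decode x)"

definition idx :: "nat \<Rightarrow> nat" where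
  "idx x = snd (prod_decode x)"

lemma cls_point [simp]: "cls (point i a) = i"
  and idx_point [simp]: "idx (point i a) = a"
  and point_cls_idx [simp]: "point (cls x) (idx x) = x"
  by (simp_all add: cls_def idx_def point_def)

lemma point_eqI: "cls x = cls y \<Longrightarrow> idx x = idx y \<Longrightarrow> x = y"
  by (metis point_cls_idx)

lemma inj_point: "inj (point i)"
  by (metis idx_point injI)

text \<open>Colour 0 makes lying in a common class definable. Edge value 0 stands for the hidden
  colour, except where the smaller index is below \<open>cls x - 1\<close>: recolouring by 1 there
  leaves those points without hidden edges.\<close>

definition col :: "nat \<Rightarrow> nat \<Rightarrow> nat option" where
  "col x y =
     (if cls x \<noteq> cls y then Some 0
      else if idx x = idx y then None
      else let a = min (idx x) (idx y); v = edge a (max (idx x) (idx y))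
        in if 0 < v then Some v else if a < cls x - 1 then Some 1 else None)"

lemma col_sym: "col x y = col y x"
  by (auto simp: col_def min.commute max.commute Let_def)

lemma col_self [simp]: "col x x = None"
  by (simp add: col_def)

lemma col_eq_Some_0: "col x y = Some 0 \<longleftrightarrow> cls x \<noteq> cls y"
  by (simp add: col_def Let_def)

text \<open>A positive edge value realises itself and value 0 realises \<open>None\<close> over any
  index not below \<open>i - 1\<close>, so \<open>edge_extend\<close> supplies the point.\<close>

lemma col_extend:
  assumes "finite F" and F: "\<forall>x\<in>F. cls x = i" and t: "\<forall>x. t x \<noteq> Some 0"
    and None: "\<forall>x\<in>F. t x = None \<longrightarrow> i - 1 \<le> idx x"
  obtains z where "cls z = i" "i - 1 \<le> idx z" "z \<notin> F" "\<forall>x\<in>F. col x z = t x"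
proof -
  define s where "s = (\<lambda>a. case t (point i a) of None \<Rightarrow> 0 | Some n \<Rightarrow> n)"
  \<comment> \<open>Inserting \<open>i - 1\<close> pushes \<open>b\<close> past the initial points
    of the class.\<close>
  obtain b where b: "\<forall>a\<in>insert (i - 1) (idx ` F). a < b \<and> edge a b = s a"
    using edge_extend[of "insert (i - 1) (idx ` F)" s] \<open>finite F\<close> by blast
  have "col x (point i b) = t x" if "x \<in> F" for x
  proof -
    have x: "cls x = i" "idx x < b" "edge (idx x) b = s (idx x)"
      using b that F by auto
    have "t x = t (point i (idx x))" using x by auto
    moreover have "t x \<noteq> Some 0" "t x = None \<longrightarrow> i - 1 \<le> idx x" using t None that by auto
    ultimately show ?thesis
      using x by (auto simp: col_def s_def min_def max_def Let_def split: option.splits)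
  qed
  moreover have "point i b \<notin> F" using b by (metis idx_point image_eqI insertCI less_irrefl)
  ultimately show ?thesis using b by (intro that[of "point i b"]) auto
qed

section \<open>Rich sets and monochromatic self-embeddings\<close>

text \<open>The extension property of the random graph with edge colours 1, 2, ... and the hidden
  one. A rich set lies within one class, because the colours prescribed by \<open>t\<close> never
  leave a class.\<close>

definition rich :: "nat set \<Rightarrow> bool" where
  "rich S \<longleftrightarrow>
     (\<forall>F t. finite F \<and> F \<subseteq> S \<and> (\<forall>x. t x \<noteq> Some 0) \<longrightarrow>
        (\<exists>z\<in>S - F. \<forall>x\<in>F. col x z = t x))"

lemma richE:
  assumes "rich S" "finite F" "F \<subseteq> S" "\<And>x. t x \<noteq> Some 0"
  obtains z where "z \<in> S - F" "\<forall>x\<in>F. col x z = t x"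
proof -
  have "\<exists>z\<in>S - F. \<forall>x\<in>F. col x z = t x"
    using assms(1)[unfolded rich_def, rule_format, of F t] assms(2-4) by blast
  then show ?thesis using that by blast
qed

text \<open>The initial points are left out because they admit no hidden edge.\<close>

lemma rich_class: "rich {x. cls x = i \<and> i - 1 \<le> idx x}"
  unfolding rich_def
proof (intro allI impI, elim conjE)
  fix F and t :: "nat \<Rightarrow> nat option"
  assume F: "finite F" "F \<subseteq> {x. cls x = i \<and> i - 1 \<le> idx x}" and t: "\<forall>x. t x \<noteq> Some 0"
  obtain z where "cls z = i" "i - 1 \<le> idx z" "z \<notin> F" "\<forall>x\<in>F. col x z = t x"
    by (rule col_extend[of F i t]) (use F t in auto)
  then show "\<exists>z\<in>{x. cls x = i \<and> i - 1 \<le> idx x} - F. \<forall>x\<in>F. col x z = t x" by auto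
qed

text \<open>If the part coloured \<open>True\<close> is not rich, some type over a finite subset of it has all its
  realisations in the other part, and the realisations of any type in a rich set are rich.\<close>

lemma rich_monochromatic:
  assumes S: "rich S"
  obtains S' b where "S' \<subseteq> S" "rich S'" "\<forall>x\<in>S'. c x = (b :: bool)"
proof (cases "rich {x\<in>S. c x}")
  case True
  then show ?thesis by (intro that[of "{x\<in>S. c x}" True]) auto
next
  case False
  then obtain F t where F: "finite F" "F \<subseteq> {x\<in>S. c x}" and t: "\<forall>x. t x \<noteq> Some 0"
    and no: "\<not> (\<exists>z\<in>{x\<in>S. c x} - F. \<forall>x\<in>F. col x z = t x)"
    unfolding rich_def by blast
  define B where "B = {z\<in>S - F. \<forall>x\<in>F. col x z = t x}"
  have "rich B"
    unfolding rich_def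
  proof (intro allI impI, elim conjE)
    fix G and s :: "nat \<Rightarrow> nat option"
    assume G: "finite G" "G \<subseteq> B" and s: "\<forall>x. s x \<noteq> Some 0"
    \<comment> \<open>Demanding \<open>t\<close> on \<open>F\<close> as well puts the new point into
      \<open>B\<close>; as \<open>B\<close> is disjoint from \<open>F\<close>, the two demands never
      clash.\<close>
    obtain z where z: "z \<in> S - (F \<union> G)"
        "\<forall>x\<in>F \<union> G. col x z = (if x \<in> F then t x else s x)"
      by (rule richE[OF S, of "F \<union> G" "\<lambda>x. if x \<in> F then t x else s x"])
        (use F G s t in \<open>auto simp: B_def\<close>)
    moreover have "\<forall>x\<in>G. x \<notin> F" using G by (auto simp: B_def)
    ultimately show "\<exists>z\<in>B - G. \<forall>x\<in>G. col x z = s x"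
      by (intro bexI[of _ z]) (auto simp: B_def)
  qed
  moreover have "\<forall>x\<in>B. c x = False" using no by (auto simp: B_def)
  ultimately show ?thesis by (intro that[of B False]) (auto simp: B_def)
qed

text \<open>Greedy construction: the image of \<open>n\<close> realises the type that
  \<open>d\<close> prescribes over the finitely many earlier images.\<close>

lemma rich_embed:
  assumes S: "rich S" and d: "\<And>a b. d a b \<noteq> Some 0"
  obtains h :: "nat \<Rightarrow> nat" where "\<forall>n. h n \<in> S" "inj h" "\<forall>a b. a < b \<longrightarrow> col (h a) (h b) = d a b"
proof -
  define P where "P = (\<lambda>h n r. r \<in> S \<and> (\<forall>a<n. h a \<noteq> r \<and> col (h a) r = d a n))"
  have "\<exists>h. \<forall>n. P h n (h n)"
  proof (rule dependent_wellorder_choice)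
    fix n h assume h: "\<And>m. m < n \<Longrightarrow> P h m (h m)"
    have inj: "inj_on h {..<n}"
      by (rule linorder_inj_onI') (use h in \<open>auto simp: P_def\<close>)
    define t where "t = (\<lambda>x. d (inv_into {..<n} h x) n)"
    obtain z where z: "z \<in> S - h ` {..<n}" "\<forall>x\<in>h ` {..<n}. col x z = t x"
      by (rule richE[OF S, of "h ` {..<n}" t]) (use h d in \<open>auto simp: P_def t_def\<close>)
    then have "P h n z"
      using inj by (auto simp: P_def t_def)
    then show "\<exists>r. P h n r" ..
  qed (auto simp: P_def)
  then obtain h where h: "\<And>n. P h n (h n)" by blast
  then show ?thesis
    by (intro that[of h] linorder_injI) (auto simp: P_def)
qed

text \<open>Every class has a rich monochromatic part, and infinitely many of these parts share a
  colour. Class \<open>k\<close> embeds into the part of class \<open>e k\<close>, hidden edges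
  included; injectivity of \<open>e\<close> preserves colour 0.\<close>

lemma monochromatic_self_embedding:
  obtains f :: "nat \<Rightarrow> nat" and b :: bool
  where "inj f" "\<forall>x y. col (f x) (f y) = col x y" "\<forall>x. c (f x) = b"
proof -
  have "\<exists>S b. S \<subseteq> {x. cls x = i} \<and> rich S \<and> (\<forall>x\<in>S. c x = (b :: bool))" for i
    using rich_monochromatic[OF rich_class[of i], of c]
    by (smt (verit) mem_Collect_eq subset_eq)
  then obtain S b where S: "\<And>i. S i \<subseteq> {x. cls x = i}" "\<And>i. rich (S i)"
    and b: "\<And>i x. x \<in> S i \<Longrightarrow> c x = (b i :: bool)"
    by metis
  have "\<exists>b'. infinite {i. b i = b'}"
  proof (rule ccontr)
    assume "\<nexists>b'. infinite {i. b i = b'}"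
    then have "finite ({i. b i = True} \<union> {i. b i = False})" by blast
    moreover have "{i. b i = True} \<union> {i. b i = False} = UNIV" by auto
    ultimately show False by (metis infinite_UNIV_nat)
  qed
  then obtain b' where inf: "infinite {i. b i = b'}" ..
  obtain e :: "nat \<Rightarrow> nat" where e: "inj e" "\<And>k. b (e k) = b'"
    using infinite_countable_subset[OF inf] by blast
  have "\<exists>h :: nat \<Rightarrow> nat. (\<forall>n. h n \<in> S (e k)) \<and> inj h \<and>
      (\<forall>a a'. a < a' \<longrightarrow> col (h a) (h a') = col (point k a) (point k a'))" for k
    by (rule rich_embed[OF S(2)[of "e k"], of "\<lambda>a a'. col (point k a) (point k a')"])
      (auto simp: col_eq_Some_0)
  then obtain h where h: "\<And>k n. h k n \<in> S (e k)" "\<And>k. inj (h k :: nat \<Rightarrow> nat)"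
      "\<And>k a a'. a < a' \<Longrightarrow> col (h k a) (h k a') = col (point k a) (point k a')"
    by metis
  have cls_h: "cls (h k a) = e k" for k a using h(1) S(1) by blast
  define f where "f = (\<lambda>x. h (cls x) (idx x))"
  have "col (f x) (f y) = col x y" for x y
  proof (cases "cls x = cls y")
    case True
    then have y: "point (cls x) (idx y) = y" by simp
    consider "idx x < idx y" | "idx x = idx y" | "idx y < idx x" by linarith
    then show ?thesis
    proof cases
      case 1
      then show ?thesis using h(3)[OF 1, of "cls x"] y by (simp add: f_def True[symmetric])
    next
      case 2
      then have "x = y" using True by (simp add: point_eqI)
      then show ?thesis by simp
    next
      case 3
      then show ?thesis using h(3)[OF 3, of "cls x"] y col_sym[of "f x" "f y"] col_sym[of x y]
        by (simp add: f_def True[symmetric])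
    qed
  next
    case False
    then have "cls (f x) \<noteq> cls (f y)" using e(1) by (simp add: f_def cls_h inj_eq)
    with False show ?thesis by (metis col_eq_Some_0)
  qed
  moreover have "inj f"
  proof (rule injI)
    fix x y assume "f x = f y"
    then have "cls x = cls y" "h (cls x) (idx x) = h (cls y) (idx y)"
      using cls_h e(1) by (auto simp: f_def inj_eq) (metis inj_eq)
    then show "x = y" using h(2) by (metis inj_eq point_eqI)
  qed
  moreover have "c (f x) = b'" for x
    using b[OF h(1)] e(2) by (simp add: f_def)
  ultimately show ?thesis by (intro that[of f b']) auto
qed

section \<open>Agreement on finitely many colours\<close>

text \<open>Equality of atomic types, restricted to variables in \<open>V\<close> and relations up
  to \<open>m\<close>; it carries the back-and-forth argument.\<close>

definition agree :: "nat \<Rightarrow> nat set \<Rightarrow> (nat \<Rightarrow> nat) \<Rightarrow> (nat \<Rightarrow> nat) \<Rightarrow> bool" where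
  "agree m V v w \<longleftrightarrow>
     (\<forall>x\<in>V. \<forall>y\<in>V. (v x = v y \<longleftrightarrow> w x = w y) \<and>
        (\<forall>n\<le>m. col (v x) (v y) = Some n \<longleftrightarrow> col (w x) (w y) = Some n))"

lemma agree_sym: "agree m V v w \<Longrightarrow> agree m V w v"
  by (auto simp: agree_def)

lemma agree_mono: "agree m V v w \<Longrightarrow> m' \<le> m \<Longrightarrow> V' \<subseteq> V \<Longrightarrow> agree m' V' v w"
  unfolding agree_def by (meson order_trans subsetD)

lemma agree_cls: "agree m V v w \<Longrightarrow> x \<in> V \<Longrightarrow> y \<in> V \<Longrightarrow> cls (v x) = cls (v y) \<longleftrightarrow> cls (w x) = cls (w y)"
  unfolding agree_def by (metis col_eq_Some_0 le0)

text \<open>Colours above \<open>m\<close> and the colour \<open>None\<close> are indistinguishable here, so both may be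
  realised by \<open>Suc m\<close>.\<close>

lemma agree_extend_point:
  assumes "finite V" and agree: "agree m V v w"
  obtains b where
    "\<forall>y\<in>V. (v y = a \<longleftrightarrow> w y = b) \<and> (\<forall>n\<le>m. col (v y) a = Some n \<longleftrightarrow> col (w y) b = Some n)"
proof -
  consider (eq) y where "y \<in> V" "v y = a"
    | (cls) y where "y \<in> V" "cls (v y) = cls a" "\<forall>z\<in>V. v z \<noteq> a"
    | (new) "\<forall>y\<in>V. cls (v y) \<noteq> cls a" by blast
  then show ?thesis
  proof cases
    case eq
    then show ?thesis using agree unfolding agree_def by (intro that[of "w y"]) auto
  next
    case cls
    let ?F = "{x \<in> w ` V. cls x = cls (w y)}"
    \<comment> \<open>As \<open>t\<close> avoids \<open>None\<close>, \<open>col_extend\<close> asks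
      for no bound on the indices in \<open>?F\<close>. The variable picked by
      \<open>inv_into\<close> is immaterial: variables with equal values under \<open>w\<close> have
      equal values under \<open>v\<close>.\<close>
    define t where "t = (\<lambda>x. case col (v (inv_into V w x)) a of
      None \<Rightarrow> Some (Suc m) | Some n \<Rightarrow> Some (if 0 < n \<and> n \<le> m then n else Suc m))"
    obtain b where b: "cls b = cls (w y)" "b \<notin> ?F" "\<forall>x\<in>?F. col x b = t x"
      by (rule col_extend[of ?F "cls (w y)" t])
        (use \<open>finite V\<close> in \<open>auto simp: t_def split: option.splits\<close>)
    have "(v z = a \<longleftrightarrow> w z = b) \<and> (\<forall>n\<le>m. col (v z) a = Some n \<longleftrightarrow> col (w z) b = Some n)"
      if z: "z \<in> V" for z
    proof (cases "cls (w z) = cls (w y)")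
      case True
      let ?z = "inv_into V w (w z)"
      have "?z \<in> V" "w ?z = w z" using z by (auto intro: inv_into_into f_inv_into_f)
      then have vz: "v ?z = v z" using agree z by (auto simp: agree_def)
      have "col (v z) a \<noteq> Some 0"
        using agree_cls[OF agree z cls(1)] True cls(2) by (simp add: col_eq_Some_0)
      moreover have "col (w z) b = t (w z)" "w z \<noteq> b" using b z True by auto
      ultimately show ?thesis
        using cls(3) z by (auto simp: t_def vz split: option.splits if_splits)
    next
      case False
      then have "cls (v z) \<noteq> cls a" using agree_cls[OF agree z cls(1)] cls(2) by simp
      moreover have "cls (w z) \<noteq> cls b" using False b(1) by simp
      ultimately show ?thesis by (metis col_eq_Some_0)
    qed
    then show ?thesis by (intro that) auto
  next
    case new
    have "finite (cls ` w ` V)" using \<open>finite V\<close> by simp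
    \<comment> \<open>A point in a class without values of \<open>w\<close> has colour 0 to all of
      them, as \<open>a\<close> has to the values of \<open>v\<close>.\<close>
    then obtain i where i: "i \<notin> cls ` w ` V" using ex_new_if_finite infinite_UNIV_nat by blast
    have "(v z = a \<longleftrightarrow> w z = point i 0) \<and>
        (\<forall>n\<le>m. col (v z) a = Some n \<longleftrightarrow> col (w z) (point i 0) = Some n)" if z: "z \<in> V" for z
    proof -
      have "cls (w z) \<noteq> cls (point i 0)" "cls (v z) \<noteq> cls a" using new i z by auto
      then show ?thesis by (metis col_eq_Some_0)
    qed
    then show ?thesis by (intro that) auto
  qed
qed

lemma agree_extend:
  assumes "finite V" and "agree m V v w"
  obtains b where "agree m V (v(x := a)) (w(x := b))"
proof -
  have V': "finite (V - {x})" "agree m (V - {x}) v w"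
    using assms by (auto intro: agree_mono)
  obtain b where b: "\<forall>y\<in>V - {x}. (v y = a \<longleftrightarrow> w y = b) \<and>
      (\<forall>n\<le>m. col (v y) a = Some n \<longleftrightarrow> col (w y) b = Some n)"
    by (rule agree_extend_point[OF V'])
  have "agree m V (v(x := a)) (w(x := b))"
    unfolding agree_def
  proof (intro ballI)
    fix y z assume "y \<in> V" "z \<in> V"
    then show "((v(x := a)) y = (v(x := a)) z \<longleftrightarrow> (w(x := b)) y = (w(x := b)) z) \<and>
        (\<forall>n\<le>m. col ((v(x := a)) y) ((v(x := a)) z) = Some n \<longleftrightarrow>
           col ((w(x := b)) y) ((w(x := b)) z) = Some n)"
      using b V'(2) col_sym[of a "v z"] col_sym[of b "w z"]
      by (cases "y = x"; cases "z = x") (auto simp: agree_def)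
  qed
  then show ?thesis by (rule that)
qed

section \<open>The structure, truth and isomorphisms\<close>

definition language :: "nat relational_language" where
  "language = \<lparr>symbols = UNIV, arity = \<lambda>_. 2\<rparr>"

definition model :: "(nat, nat) fo_structure" where
  "model = \<lparr>universe = UNIV, interp = \<lambda>n. {[x, y] | x y. col x y = Some n}\<rparr>"

lemma symbols_language [simp]: "symbols language = UNIV"
  by (simp add: language_def)

lemma tuples_language: "tuples language n A = {[x, y] | x y. x \<in> A \<and> y \<in> A}"
  by (auto simp: tuples_def language_def numeral_2_eq_2 length_Suc_conv)

text \<open>Induction on the formula. Extending an agreement costs no colours, so a quantifier
  leaves \<open>m\<close> and \<open>V\<close> unchanged.\<close>

lemma satisfies_agree:
  "\<exists>m V. finite V \<and> (\<forall>v w. agree m V v w \<longrightarrow> satisfies model v p \<longleftrightarrow> satisfies model w p)"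
proof (induction p)
  case (Equal x y)
  show ?case by (rule exI[of _ 0], rule exI[of _ "{x, y}"]) (auto simp: agree_def)
next
  case (Rel R xs)
  \<comment> \<open>Symbols are colours, so \<open>R\<close> itself serves as the bound
    \<open>m\<close>.\<close>
  have "map v xs \<in> interp model R" if agree: "agree R (set xs) w v" and w: "map w xs \<in> interp model R" for v w
  proof -
    obtain x y where "xs = [x, y]" using w by (auto simp: model_def)
    then show ?thesis using agree w by (auto simp: model_def agree_def)
  qed
  then show ?case
    by (intro exI[of _ R] exI[of _ "set xs"]) (auto intro: agree_sym)
next
  case (Neg p)
  then show ?case by simp
next
  case (Conj p q)
  obtain m V where p: "finite V"
    "\<forall>v w. agree m V v w \<longrightarrow> satisfies model v p \<longleftrightarrow> satisfies model w p"
    using Conj.IH(1) by (elim exE conjE)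
  obtain m' V' where q: "finite V'"
    "\<forall>v w. agree m' V' v w \<longrightarrow> satisfies model v q \<longleftrightarrow> satisfies model w q"
    using Conj.IH(2) by (elim exE conjE)
  have "satisfies model v (Conj p q) \<longleftrightarrow> satisfies model w (Conj p q)"
    if "agree (max m m') (V \<union> V') v w" for v w
    using p(2) q(2) agree_mono[OF that, of m V] agree_mono[OF that, of m' V'] by simp
  then show ?case
    using p(1) q(1) by (intro exI[of _ "max m m'"] exI[of _ "V \<union> V'"]) auto
next
  case (Exists x p)
  obtain m V where p: "finite V"
    "\<forall>v w. agree m V v w \<longrightarrow> satisfies model v p \<longleftrightarrow> satisfies model w p"
    using Exists.IH by (elim exE conjE)
  have "satisfies model w (Exists x p)" if agree: "agree m V v w" and v: "satisfies model v (Exists x p)" for v w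
  proof -
    obtain a where a: "satisfies model (v(x := a)) p" using v by auto
    obtain b where "agree m V (v(x := a)) (w(x := b))" by (rule agree_extend[OF p(1) agree])
    then have "satisfies model (w(x := b)) p" using a p(2) by blast
    then show ?thesis by (auto simp: model_def)
  qed
  then show ?case using p(1) agree_sym by (intro exI[of _ m] exI[of _ V]) blast
qed

lemma satisfies_isomorphism:
  assumes "isomorphism L M N f"
  shows "is_formula L p \<Longrightarrow> range v \<subseteq> universe M \<Longrightarrow>
    satisfies M v p \<longleftrightarrow> satisfies N (f \<circ> v) p"
proof (induction p arbitrary: v)
  case (Equal x y)
  then have "v x \<in> universe M" "v y \<in> universe M" by auto
  moreover have "inj_on f (universe M)" using assms by (simp add: isomorphism_def bij_betw_def)
  ultimately show ?case by (simp add: inj_on_eq_iff)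
next
  case (Rel R xs)
  then have "map v xs \<in> tuples L R (universe M)" by (auto simp: tuples_def)
  with assms Rel show ?case by (simp add: isomorphism_def comp_def)
next
  case (Exists x p)
  have "universe N = f ` universe M" using assms by (auto simp: isomorphism_def bij_betw_def)
  moreover have "satisfies M (v(x := a)) p \<longleftrightarrow> satisfies N ((f \<circ> v)(x := f a)) p"
    if "a \<in> universe M" for a
  proof -
    have "f \<circ> v(x := a) = (f \<circ> v)(x := f a)" by (auto simp: fun_eq_iff)
    moreover have "range (v(x := a)) \<subseteq> universe M" using Exists.prems(2) that by auto
    ultimately show ?thesis using Exists.IH[of "v(x := a)"] Exists.prems(1)
      by (metis is_formula.simps(5))
  qed
  ultimately show ?case by (auto simp: comp_def)
qed auto

lemma isomorphism_inverse:
  assumes "isomorphism L M N f"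
  shows "isomorphism L N M (inv_into (universe M) f)"
proof -
  let ?g = "inv_into (universe M) f"
  have bij: "bij_betw f (universe M) (universe N)" using assms by (simp add: isomorphism_def)
  have "xs \<in> interp N R \<longleftrightarrow> map ?g xs \<in> interp M R"
    if "R \<in> symbols L" "xs \<in> tuples L R (universe N)" for R xs
  proof -
    have xs: "set xs \<subseteq> f ` universe M" using that(2) bij by (simp add: tuples_def bij_betw_def)
    then have "map ?g xs \<in> tuples L R (universe M)"
      using that(2) by (auto simp: tuples_def intro: inv_into_into)
    moreover have "map f (map ?g xs) = xs"
      using xs by (auto simp: f_inv_into_f intro!: map_idI)
    ultimately show ?thesis using assms that(1) by (metis isomorphism_def)
  qed
  then show ?thesis using bij_betw_inv_into[OF bij] by (simp add: isomorphism_def)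
qed

text \<open>Hidden pairs are those in no relation at all, so isomorphisms, unlike single formulas,
  respect the hidden colour.\<close>

lemma isomorphism_col:
  assumes "substructure language N model" "substructure language N' model"
  shows "isomorphism language N N' f \<longleftrightarrow>
    bij_betw f (universe N) (universe N') \<and>
    (\<forall>x\<in>universe N. \<forall>y\<in>universe N. col (f x) (f y) = col x y)"
proof -
  have interp: "[x, y] \<in> interp K R \<longleftrightarrow> col x y = Some R"
    if "substructure language K model" "x \<in> universe K" "y \<in> universe K" for K R x y
  proof -
    have "interp K R = interp model R \<inter> tuples language R (universe K)"
      using that(1) by (simp add: substructure_def)
    then show ?thesis using that by (simp add: model_def tuples_language)
  qed
  have eq: "(\<forall>R. c = Some R \<longleftrightarrow> d = Some R) \<longleftrightarrow> d = c" for c d :: "nat option"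
    by (metis not_Some_eq)
  have "(\<forall>R\<in>symbols language. \<forall>xs\<in>tuples language R (universe N).
      xs \<in> interp N R \<longleftrightarrow> map f xs \<in> interp N' R) \<longleftrightarrow>
    (\<forall>x\<in>universe N. \<forall>y\<in>universe N. \<forall>R. [x, y] \<in> interp N R \<longleftrightarrow> [f x, f y] \<in> interp N' R)"
    by (auto simp: tuples_language)
  also have "\<dots> \<longleftrightarrow> (\<forall>x\<in>universe N. \<forall>y\<in>universe N. col (f x) (f y) = col x y)"
    if "bij_betw f (universe N) (universe N')"
    using that bij_betwE[OF that] by (simp add: interp[OF assms(1)] interp[OF assms(2)] eq)
  finally show ?thesis by (auto simp: isomorphism_def)
qed

lemma is_structure_model: "is_structure language model"
  by (auto simp: is_structure_def model_def tuples_language)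

lemma substructure_model: "substructure language model model"
  using is_structure_model by (auto simp: substructure_def is_structure_def)

lemma universe_model [simp]: "universe model = UNIV"
  by (simp add: model_def)

section \<open>Elementary indivisibility\<close>

lemma elementarily_indivisible_model: "elementarily_indivisible language model"
  unfolding elementarily_indivisible_def
proof
  fix c :: "nat \<Rightarrow> bool"
  obtain f :: "nat \<Rightarrow> nat" and b where f: "inj f" "\<forall>x y. col (f x) (f y) = col x y"
    and mono: "\<forall>x. c (f x) = b"
    by (rule monochromatic_self_embedding)
  define N :: "(nat, nat) fo_structure" where
    "N = \<lparr>universe = range f, interp = \<lambda>R. interp model R \<inter> tuples language R (range f)\<rparr>"
  have sub: "substructure language N model"
    by (auto simp: substructure_def is_structure_def N_def)
  have iso: "isomorphism language model N f"
    unfolding isomorphism_col[OF substructure_model sub]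
    using f by (simp add: N_def bij_betw_def)
  have "satisfies N v p \<longleftrightarrow> satisfies model v p"
    if "is_formula language p" "range v \<subseteq> universe N" for v p
  proof -
    \<comment> \<open>Truth in \<open>N\<close> at \<open>v\<close> is truth in the model at
      \<open>u\<close>, and \<open>u\<close> and \<open>v\<close> agree for all \<open>m\<close> and
      \<open>V\<close> since \<open>f\<close> preserves colours.\<close>
    define u where "u = inv f \<circ> v"
    have v: "v = f \<circ> u"
      using that(2) by (auto simp: u_def N_def fun_eq_iff f_inv_into_f image_subset_iff)
    have "satisfies N v p \<longleftrightarrow> satisfies model u p"
      using satisfies_isomorphism[OF iso that(1)] by (simp add: v)
    moreover have "agree m V u v" for m V
      using f by (simp add: agree_def v inj_eq)
    ultimately show ?thesis using satisfies_agree[of p] by blast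
  qed
  then have "elementary_substructure language N model"
    using sub by (simp add: elementary_substructure_def)
  moreover have "isomorphic language N model"
    using isomorphism_inverse[OF iso] by (auto simp: isomorphic_def)
  moreover have "monochromatic c N"
    using mono by (auto simp: monochromatic_def N_def)
  ultimately show "\<exists>N. substructure language N model \<and> monochromatic c N \<and>
      isomorphic language N model \<and> elementary_substructure language N model"
    using sub by blast
qed

section \<open>Class invariants and failure of symmetric indivisibility\<close>

text \<open>Isolated in the graph of hidden edges; the diagonal, also \<open>None\<close>, is
  exempt.\<close>

definition isolated :: "nat \<Rightarrow> nat set" where
  "isolated i = {x. cls x = i \<and> (\<forall>y. col x y = None \<longrightarrow> y = x)}"

text \<open>From index \<open>i - 1\<close> on, \<open>col_extend\<close> supplies a hidden
  neighbour; below it, \<open>col\<close> turns hidden edges into colour 1.\<close>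

lemma isolated_eq: "isolated i = point i ` {..<i - 1}"
proof (intro equalityI subsetI)
  fix x assume x: "x \<in> isolated i"
  then have i: "cls x = i" and iso: "\<And>y. col x y = None \<Longrightarrow> y = x" by (auto simp: isolated_def)
  have "idx x < i - 1"
  proof (rule ccontr)
    assume "\<not> idx x < i - 1"
    then obtain z where "z \<notin> {x}" "\<forall>y\<in>{x}. col y z = None"
      using col_extend[of "{x}" i "\<lambda>_. None"] i by auto
    then show False using iso by auto
  qed
  then show "x \<in> point i ` {..<i - 1}" using i by (metis image_eqI lessThan_iff point_cls_idx)
next
  fix x assume "x \<in> point i ` {..<i - 1}"
  then show "x \<in> isolated i"
    by (auto simp: isolated_def col_def Let_def min_def intro: point_eqI split: if_splits)
qed

lemma card_isolated: "card (isolated i) = i - 1"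
  by (simp add: isolated_eq card_image inj_on_subset[OF inj_point])

text \<open>The number \<open>i - 1\<close> of isolated points is an invariant of class
  \<open>i\<close> and determines \<open>i\<close> among positive indices; classes 0 and 1 share the
  value 0.\<close>

lemma col_automorphism_cls:
  assumes g: "bij g" "\<And>x y. col (g x) (g y) = col x y"
    and x: "0 < cls x" "0 < cls (g x)"
  shows "cls (g x) = cls x"
proof -
  have cls: "cls (g y) = cls (g z) \<longleftrightarrow> cls y = cls z" for y z
    using g(2) by (metis col_eq_Some_0)
  have iso: "g y \<in> isolated (cls (g x)) \<longleftrightarrow> y \<in> isolated (cls x)" for y
  proof -
    have "(\<forall>z. col (g y) z = None \<longrightarrow> z = g y) \<longleftrightarrow> (\<forall>z. col (g y) (g z) = None \<longrightarrow> g z = g y)"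
      using g(1) by (metis bij_pointE)
    then show ?thesis
      using g by (simp add: isolated_def cls bij_is_inj inj_eq)
  qed
  have "g ` isolated (cls x) = isolated (cls (g x))"
    using iso g(1) by (auto simp: image_iff) (metis bij_pointE)
  then have "card (isolated (cls (g x))) = card (isolated (cls x))"
    using g(1) by (metis bij_is_inj card_image inj_on_subset subset_UNIV)
  then show ?thesis using x by (simp add: card_isolated)
qed

text \<open>Truncated subtraction makes the classes \<open>0\<close> and \<open>1\<close> isomorphic.\<close>

definition swap :: "nat \<Rightarrow> nat" where
  "swap x = (if cls x = 0 then point 1 (idx x) else if cls x = 1 then point 0 (idx x) else x)"

lemma swap_swap [simp]: "swap (swap x) = x"
  by (auto simp: swap_def intro: point_eqI)

lemma col_swap: "col (swap x) (swap y) = col x y"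
  by (auto simp: swap_def col_def Let_def)

lemma not_symmetrically_indivisible_model: "\<not> symmetrically_indivisible language model"
proof
  assume "symmetrically_indivisible language model"
  then obtain N where sub: "substructure language N model"
    and mono: "monochromatic (\<lambda>x. cls x < 2) N" and "isomorphic language N model"
    and sym: "symmetrically_embedded language N model"
    unfolding symmetrically_indivisible_def by blast
  then obtain f' where "isomorphism language N model f'" by (auto simp: isomorphic_def)
  then obtain f where f: "isomorphism language model N f"
    using isomorphism_inverse by blast
  then have inj: "inj f" and range: "range f = universe N" and col: "\<And>x y. col (f x) (f y) = col x y"
    unfolding isomorphism_col[OF substructure_model sub] by (auto simp: bij_betw_def)
  let ?i = "\<lambda>k. cls (f (point k 0))"
  have distinct: "?i k \<noteq> ?i l" if "k \<noteq> l" for k l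
    using col[of "point k 0" "point l 0"] that by (metis col_eq_Some_0 cls_point)
  \<comment> \<open>One red point makes all of \<open>N\<close> red, but classes 0, 1 and 2 of the
    copy lie in three distinct classes of the model, of which only two are red.\<close>
  have "\<forall>k. \<not> ?i k < 2"
  proof (rule ccontr)
    assume "\<not> (\<forall>k. \<not> ?i k < 2)"
    then have "?i k < 2" for k using mono range unfolding monochromatic_def by blast
    from this[of 0] this[of 1] this[of 2] distinct[of 0 1] distinct[of 1 2] distinct[of 0 2]
    show False by linarith
  qed
  then have ge: "0 < ?i k" for k by (metis gr0I zero_less_numeral)
  \<comment> \<open>The swap of classes 0 and 1, transported to \<open>N\<close> along
    \<open>f\<close>.\<close>
  define s where "s = (\<lambda>x. f (swap (inv f x)))"
  have s: "s (f x) = f (swap x)" for x using inj by (simp add: s_def)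
  have "bij_betw s (universe N) (universe N)"
    by (rule bij_betw_byWitness[where f' = s]) (auto simp: range[symmetric] s)
  then have "automorphism language N s"
    unfolding isomorphism_col[OF sub sub] by (auto simp: range[symmetric] s col col_swap)
  then obtain g where g: "automorphism language model g" and "\<forall>x\<in>universe N. g x = s x"
    using sym unfolding symmetrically_embedded_def by blast
  then have "g (f (point 0 0)) = f (point 1 0)"
    by (auto simp: range[symmetric] s swap_def)
  moreover have "bij g" "\<And>x y. col (g x) (g y) = col x y"
    using g unfolding isomorphism_col[OF substructure_model substructure_model] by auto
  \<comment> \<open>\<open>g\<close> joins two classes of positive index, so the count of isolated
    points forces equal indices.\<close>
  ultimately have "?i 1 = ?i 0"
    using col_automorphism_cls[of g "f (point 0 0)"] ge[of 0] ge[of 1] by simp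
  then show False using distinct[of 1 0] by simp
qed

theorem theorem4p4:
  "\<exists>(L :: nat relational_language) (M :: (nat, nat) fo_structure).
     is_language L \<and> is_structure L M \<and>
     elementarily_indivisible L M \<and> \<not> symmetrically_indivisible L M"
  using is_structure_model elementarily_indivisible_model not_symmetrically_indivisible_model
  by (intro exI[of _ language] exI[of _ model]) (simp add: is_language_def language_def)

end
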